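(* There exist a fractal structure $\mathbf{\Gamma}=\{\Gamma_n\}_{n\in\mathbb{N}}$ on $[0,1]$ and a continuous curve $\beta:[0,1]\to[0,1]\times[0,1]$ filling the whole unit square (i.e. $\beta([0,1])=[0,1]\times[0,1]$) such that, writing $\mathbf{\Delta}=\{\Delta_n\}_{n\in\mathbb{N}}$ for the fractal structure induced by $\mathbf{\Gamma}$ on $\beta([0,1])$, (i) for each $n\in\mathbb{N}$ some element of $\Delta_n$ is crossed twice by $\beta$, i.e. there are two distinct elements $A\ne A'$ of $\Gamma_n$ with $\beta(A)=\beta(A')$; and (ii) the fractal dimension $\dim_{\mathbf{\Gamma}}(\beta)$ of the parametrization $\beta$ is different from both the box dimension $\dim_B(\beta([0,1]))$ and the Hausdorff dimension $\dim_H(\beta([0,1]))$ of the image set.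
   Context: Fractal structures. A covering of a set $X$ is a family $\Gamma$ of subsets of $X$ with union $X$; the same set is allowed to appear several times in a covering, and sums over elements of a covering are taken with multiplicity. $\Gamma_1\prec\Gamma_2$ means that each $A\in\Gamma_1$ is contained in some $B\in\Gamma_2$; $\Gamma_1\prec\prec\Gamma_2$ means that $\Gamma_1\prec\Gamma_2$ and for all $B\in\Gamma_2$, $B=\bigcup\{A\in\Gamma_1:A\subseteq B\}$. A fractal structure on $X$ is a sequence $\mathbf{\Gamma}=\{\Gamma_n\}_{n\in\mathbb{N}}$ of coverings of $X$ with $\Gamma_{n+1}\prec\prec\Gamma_n$ for all $n$. Induced fractal structure. For a parametrization of a curve $\alpha:[0,1]\to X$ in a metric space $X$ and a fractal structure $\mathbf{\Gamma}$ on $[0,1]$, the fractal structure induced by $\mathbf{\Gamma}$ on $\alpha([0,1])$ is $\mathbf{\Delta}=\{\Delta_n\}_{n\in\mathbb{N}}$ with $\Delta_n=\{\alpha(A):A\in\Gamma_n\}$, regarded as a family indexed by $A\in\Gamma_n$ (so repeated images are counted with multiplicity). Fractal dimension of a curve. $\dim_{\mathbf{\Gamma}}(\alpha)$ is the fractal dimension III of $F=\alpha([0,1])$ with respect to $\mathbf{\Delta}$, defined (assuming $\sup\{\operatorname{diam}(B):B\in\Delta_n\}\to0$) as follows: for $s\ge0$ put $\mathcal{H}^s_{n,3}(F)=\inf\{\sum_{B\in\Delta_l,\,B\cap F\neq\emptyset}\operatorname{diam}(B)^s:l\ge n\}$ and $\mathcal{H}^s_3(F)=\lim_{n\to\infty}\mathcal{H}^s_{n,3}(F)$;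 then the dimension is $\inf\{s:\mathcal{H}^s_3(F)=0\}=\sup\{s:\mathcal{H}^s_3(F)=\infty\}$. Here the plane carries the Euclidean distance. $\dim_B(F)=\lim_{\delta\to0}\frac{\log N_\delta(F)}{-\log\delta}$ for $F\subseteq\mathbb{R}^2$, with $N_\delta(F)$ the number of squares $[k_1\delta,(k_1+1)\delta]\times[k_2\delta,(k_2+1)\delta]$, $k_i\in\mathbb{Z}$, meeting $F$; $\dim_H$ is the usual Hausdorff dimension. *)

theory Defs
  imports "HOL-Analysis.Analysis"
begin

section \<open>Coverings with multiplicity and fractal structures\<close>

text \<open>
  Since the same set may occur several times in a covering, a covering is an indexed family:
  an index set \<open>I\<close> together with a map \<open>A\<close> that sends each index to a set.
  For coverings of a set of reals, the index type \<open>real set\<close> is large enough: a covering without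
  repetitions is indexed by its own members.
\<close>

type_synonym ('i, 'a) family = "'i set \<times> ('i \<Rightarrow> 'a set)"

definition members :: "('i, 'a) family \<Rightarrow> 'a set set" where
  "members \<Gamma> = snd \<Gamma> ` fst \<Gamma>"

definition covering :: "'a set \<Rightarrow> ('i, 'a) family \<Rightarrow> bool" where
  "covering X \<Gamma> \<longleftrightarrow> \<Union> (members \<Gamma>) = X"

definition refines :: "('i, 'a) family \<Rightarrow> ('i, 'a) family \<Rightarrow> bool" where
  "refines \<Gamma>1 \<Gamma>2 \<longleftrightarrow> (\<forall>A\<in>members \<Gamma>1. \<exists>B\<in>members \<Gamma>2. A \<subseteq> B)"

definition strongly_refines :: "('i, 'a) family \<Rightarrow> ('i, 'a) family \<Rightarrow> bool" where
  "strongly_refines \<Gamma>1 \<Gamma>2 \<longleftrightarrow>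
     refines \<Gamma>1 \<Gamma>2 \<and> (\<forall>B\<in>members \<Gamma>2. B = \<Union> {A \<in> members \<Gamma>1. A \<subseteq> B})"

definition fractal_structure :: "'a set \<Rightarrow> (nat \<Rightarrow> ('i, 'a) family) \<Rightarrow> bool" where
  "fractal_structure X \<Gamma> \<longleftrightarrow>
     (\<forall>n. covering X (\<Gamma> n)) \<and> (\<forall>n. strongly_refines (\<Gamma> (Suc n)) (\<Gamma> n))"

text \<open>The image family keeps the index set, so repeated images count with multiplicity.\<close>

definition induced ::
  "('a \<Rightarrow> 'b) \<Rightarrow> (nat \<Rightarrow> ('i, 'a) family) \<Rightarrow> nat \<Rightarrow> ('i, 'b) family" where
  "induced \<alpha> \<Gamma> n = (fst (\<Gamma> n), \<lambda>i. \<alpha> ` snd (\<Gamma> n) i)"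

lemma fractal_structure_induced:
  assumes "fractal_structure X \<Gamma>"
  shows "fractal_structure (\<alpha> ` X) (induced \<alpha> \<Gamma>)"
proof -
  have mem: "members (induced \<alpha> \<Gamma> n) = image \<alpha> ` members (\<Gamma> n)" for n
    by (simp add: members_def induced_def image_image)
  have "\<Union> (members (induced \<alpha> \<Gamma> n)) = \<alpha> ` X" for n
  proof -
    have "\<Union> (members (\<Gamma> n)) = X"
      using assms by (simp add: fractal_structure_def covering_def)
    then show ?thesis by (simp add: mem flip: image_Union)
  qed
  moreover have "\<exists>B\<in>members (induced \<alpha> \<Gamma> n). A \<subseteq> B"
    if A: "A \<in> members (induced \<alpha> \<Gamma> (Suc n))" for n A
  proof -
    obtain A0 where A0: "A = \<alpha> ` A0" "A0 \<in> members (\<Gamma> (Suc n))"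
      using A unfolding mem by (rule imageE)
    then obtain B0 where "B0 \<in> members (\<Gamma> n)" "A0 \<subseteq> B0"
      using assms unfolding fractal_structure_def strongly_refines_def refines_def by meson
    then show ?thesis by (auto simp: mem A0(1) intro!: bexI[of _ B0])
  qed
  moreover have "B = \<Union> {A \<in> members (induced \<alpha> \<Gamma> (Suc n)). A \<subseteq> B}"
    if B: "B \<in> members (induced \<alpha> \<Gamma> n)" for n B
  proof (intro equalityI subsetI)
    fix y assume "y \<in> B"
    obtain B0 where B0: "B = \<alpha> ` B0" "B0 \<in> members (\<Gamma> n)"
      using B unfolding mem by (rule imageE)
    obtain x where x: "x \<in> B0" "y = \<alpha> x" using \<open>y \<in> B\<close> B0(1) by auto
    have "B0 = \<Union> {A \<in> members (\<Gamma> (Suc n)). A \<subseteq> B0}"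
      using assms B0(2) unfolding fractal_structure_def strongly_refines_def by meson
    then obtain A0 where A0: "A0 \<in> members (\<Gamma> (Suc n))" "A0 \<subseteq> B0" "x \<in> A0"
      using x(1) by blast
    have "\<alpha> ` A0 \<in> members (induced \<alpha> \<Gamma> (Suc n))" using A0(1) by (simp add: mem)
    moreover have "\<alpha> ` A0 \<subseteq> B" using A0(2) B0(1) by (simp add: image_mono)
    moreover have "y \<in> \<alpha> ` A0" using A0(3) x(2) by simp
    ultimately show "y \<in> \<Union> {A \<in> members (induced \<alpha> \<Gamma> (Suc n)). A \<subseteq> B}" by blast
  qed blast
  ultimately show ?thesis
    by (simp only: fractal_structure_def covering_def strongly_refines_def refines_def) blast
qed

section \<open>Fractal dimension III\<close>

text \<open>
  The \<open>s\<close>-th power of the diameter, with the usual conventions: a nonempty set contributes \<open>1\<close>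
  for \<open>s = 0\<close> (whereas \<open>0 powr 0 = 0\<close>), the empty set contributes \<open>0\<close>. Only meaningful for
  bounded sets, because \<^const>\<open>diameter\<close> is unspecified otherwise.
\<close>

definition diam_pow :: "real \<Rightarrow> 'a::metric_space set \<Rightarrow> ennreal" where
  "diam_pow s B = (if B = {} then 0 else if s = 0 then 1 else ennreal (diameter B powr s))"

definition diam_vanishing :: "(nat \<Rightarrow> ('i, 'a::metric_space) family) \<Rightarrow> bool" where
  "diam_vanishing \<Delta> \<longleftrightarrow>
     (\<forall>n. \<forall>B\<in>members (\<Delta> n). bounded B) \<and>
     (\<lambda>n. SUP B\<in>members (\<Delta> n). ennreal (diameter B)) \<longlonglongrightarrow> 0"

definition H3n :: "(nat \<Rightarrow> ('i, 'a::metric_space) family) \<Rightarrow> 'a set \<Rightarrow> real \<Rightarrow> nat \<Rightarrow> ennreal" where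
  "H3n \<Delta> F s n =
     (INF l\<in>{n..}. \<Sum>\<^sub>\<infinity>i\<in>{i \<in> fst (\<Delta> l). snd (\<Delta> l) i \<inter> F \<noteq> {}}. diam_pow s (snd (\<Delta> l) i))"

definition H3 :: "(nat \<Rightarrow> ('i, 'a::metric_space) family) \<Rightarrow> 'a set \<Rightarrow> real \<Rightarrow> ennreal" where
  "H3 \<Delta> F s = lim (H3n \<Delta> F s)"

text \<open>Dimensions are extended reals; the infimum of the empty set is \<open>\<infinity>\<close>.\<close>

definition fractal_dim3 :: "(nat \<Rightarrow> ('i, 'a::metric_space) family) \<Rightarrow> 'a set \<Rightarrow> ereal" where
  "fractal_dim3 \<Delta> F = Inf {ereal s | s. 0 \<le> s \<and> H3 \<Delta> F s = 0}"

definition curve_dim ::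
  "(nat \<Rightarrow> ('i, real) family) \<Rightarrow> (real \<Rightarrow> 'a::metric_space) \<Rightarrow> ereal" where
  "curve_dim \<Gamma> \<alpha> = fractal_dim3 (induced \<alpha> \<Gamma>) (\<alpha> ` {0..1})"

section \<open>Box and Hausdorff dimension\<close>

definition grid_square :: "real \<Rightarrow> int \<times> int \<Rightarrow> (real \<times> real) set" where
  "grid_square \<delta> k =
     {of_int (fst k) * \<delta> .. (of_int (fst k) + 1) * \<delta>} \<times>
     {of_int (snd k) * \<delta> .. (of_int (snd k) + 1) * \<delta>}"

text \<open>For bounded \<open>F\<close>; on an infinite set \<^const>\<open>card\<close> is \<open>0\<close>.\<close>

definition box_count :: "(real \<times> real) set \<Rightarrow> real \<Rightarrow> nat" where
  "box_count F \<delta> = card {k. grid_square \<delta> k \<inter> F \<noteq> {}}"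

definition has_box_dim :: "(real \<times> real) set \<Rightarrow> ereal \<Rightarrow> bool" where
  "has_box_dim F d \<longleftrightarrow>
     ((\<lambda>\<delta>. ereal (ln (real (box_count F \<delta>)) / (- ln \<delta>))) \<longlongrightarrow> d) (at_right 0)"

definition hausdorff_pre :: "real \<Rightarrow> real \<Rightarrow> 'a::metric_space set \<Rightarrow> ennreal" where
  "hausdorff_pre s \<delta> F =
     (INF U\<in>{U :: nat \<Rightarrow> 'a set. F \<subseteq> (\<Union>i. U i) \<and> (\<forall>i. bounded (U i) \<and> diameter (U i) \<le> \<delta>)}.
        \<Sum>i. diam_pow s (U i))"

definition hausdorff_measure :: "real \<Rightarrow> 'a::metric_space set \<Rightarrow> ennreal" where
  "hausdorff_measure s F = (SUP \<delta>\<in>{0<..}. hausdorff_pre s \<delta> F)"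

definition hausdorff_dim :: "'a::metric_space set \<Rightarrow> ereal" where
  "hausdorff_dim F = Inf {ereal s | s. 0 \<le> s \<and> hausdorff_measure s F = 0}"

end

theory Submission
  imports Defs "HOL-Real_Asymp.Real_Asymp"
begin

text \<open>
  Six maps of ratio \<open>1/2\<close> carry the diagonal of the unit square to the path
  \<open>(0,0), (1/2,1/2), (1,0), (1/2,1/2), (0,1), (1/2,1/2), (1,1)\<close>. Consecutive pieces fit together, so
  the maps define a self-similar continuous curve parametrized by base 6 expansions; their images
  cover the square, so the curve fills it, and the two quarters off the diagonal are each crossed
  twice. At level \<open>l\<close> there are \<open>6 ^ l\<close> pieces of diameter comparable to \<open>(1/2) ^ l\<close>, so the curve
  has dimension \<open>ln 6 / ln 2 > 5 / 2\<close>, whereas the square has dimension 2.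
\<close>

section \<open>The curve\<close>

abbreviation unit_square :: "(real \<times> real) set" where
  "unit_square \<equiv> {0..1} \<times> {0..1}"

text \<open>The signs orient each quarter so that the diagonal from \<open>(0, 0)\<close> to
  \<open>(1, 1)\<close> lands on the right step of the path. Maps 1 and 2 share the lower right
  quarter, maps 3 and 4 the upper left one, each pair running along its diagonal in opposite
  directions.\<close>

definition quad :: "nat \<Rightarrow> real \<times> real \<Rightarrow> real \<times> real" where
  "quad k p = (case p of (x, y) \<Rightarrow>
     if k = 0 then (x / 2, y / 2)
     else if k = 1 then (1 / 2 + x / 2, 1 / 2 - y / 2)
     else if k = 2 then (1 - x / 2, y / 2)
     else if k = 3 then (1 / 2 - x / 2, 1 / 2 + y / 2)
     else if k = 4 then (x / 2, 1 - y / 2)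
     else (1 / 2 + x / 2, 1 / 2 + y / 2))"

lemma dist_quad: "dist (quad k p) (quad k q) = dist p q / 2"
proof -
  have aux: "sqrt ((a / 2)\<^sup>2 + (b / 2)\<^sup>2) = sqrt (a\<^sup>2 + b\<^sup>2) / 2" for a b :: real
  proof -
    have "(a / 2)\<^sup>2 + (b / 2)\<^sup>2 = (a\<^sup>2 + b\<^sup>2) / 4"
      by (simp add: power_divide add_divide_distrib)
    then show ?thesis by (simp only: real_sqrt_divide real_sqrt_four)
  qed
  have half: "dist (c + x / 2) (c + y / 2) = dist x y / 2"
    "dist (c - x / 2) (c - y / 2) = dist x y / 2" "dist (x / 2) (y / 2) = dist x y / 2"
    for c x y :: real
    by (auto simp: dist_real_def abs_if field_simps)
  show ?thesis
    by (cases p; cases q) (simp add: quad_def dist_Pair_Pair half aux)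
qed

lemma quad_in_unit_square: "p \<in> unit_square \<Longrightarrow> quad k p \<in> unit_square"
  by (auto simp: quad_def)

text \<open>Maps 0, 2, 4 and 5 carry the square onto its four closed quarters; the witnesses below
  are their inverses.\<close>

lemma quad_covers_unit_square:
  assumes "p \<in> unit_square"
  obtains k q where "k < 6" "q \<in> unit_square" "p = quad k q"
proof -
  obtain x y where p: "p = (x, y)" "0 \<le> x" "x \<le> 1" "0 \<le> y" "y \<le> 1"
    using assms by auto
  have "\<exists>k<6. \<exists>q\<in>unit_square. p = quad k q"
  proof (cases "x \<le> 1 / 2"; cases "y \<le> 1 / 2")
    assume "x \<le> 1 / 2" "y \<le> 1 / 2"
    then show ?thesis using p
      by (intro exI[of _ 0] conjI bexI[of _ "(2 * x, 2 * y)"]) (auto simp: quad_def diff_divide_distrib)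
  next
    assume "x \<le> 1 / 2" "\<not> y \<le> 1 / 2"
    then show ?thesis using p
      by (intro exI[of _ 4] conjI bexI[of _ "(2 * x, 2 - 2 * y)"]) (auto simp: quad_def diff_divide_distrib)
  next
    assume "\<not> x \<le> 1 / 2" "y \<le> 1 / 2"
    then show ?thesis using p
      by (intro exI[of _ 2] conjI bexI[of _ "(2 - 2 * x, 2 * y)"]) (auto simp: quad_def diff_divide_distrib)
  next
    assume "\<not> x \<le> 1 / 2" "\<not> y \<le> 1 / 2"
    then show ?thesis using p
      by (intro exI[of _ 5] conjI bexI[of _ "(2 * x - 1, 2 * y - 1)"]) (auto simp: quad_def diff_divide_distrib)
  qed
  then show ?thesis using that by blast
qed

text \<open>These are the joints of the path; they make the concatenation of the six pieces well
  defined and continuous.\<close>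

lemma quad_match: "k < 5 \<Longrightarrow> quad k (1, 1) = quad (Suc k) (0, 0)"
  by (auto simp: quad_def less_Suc_eq numeral_eq_Suc)

text \<open>Map 2 is map 1 after the half-turn about the centre. The half-turn preserves the square,
  so both maps have the same image: the source of the double crossing.\<close>

lemma quad_1_2: "quad 2 (x, y) = quad 1 (1 - x, 1 - y)"
  by (simp add: quad_def field_simps)

lemma continuous_on_quad: "continuous_on X (quad k)"
  by (rule lipschitz_on_continuous_on[of "1 / 2"], rule lipschitz_onI) (simp_all add: dist_quad)

section \<open>Piecewise linear approximations\<close>

fun approx_curve :: "nat \<Rightarrow> real \<Rightarrow> real \<times> real" where
  "approx_curve 0 t = (t, t)"
| "approx_curve (Suc n) t =
     (let k = min 5 (nat \<lfloor>6 * t\<rfloor>) in quad k (approx_curve n (6 * t - real k)))"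

lemma approx_curve_0: "approx_curve n 0 = (0, 0)"
  by (induction n) (simp_all add: quad_def)

lemma approx_curve_1: "approx_curve n 1 = (1, 1)"
  by (induction n) (simp_all add: quad_def)

text \<open>Replaces the recursion through \<open>floor\<close> by a rule on closed sixths, where
  both endpoints are allowed.\<close>

lemma approx_curve_Suc:
  assumes "k < 6" "u \<in> {0..1}"
  shows "approx_curve (Suc n) ((real k + u) / 6) = quad k (approx_curve n u)"
proof (cases "u < 1")
  case True
  then have "\<lfloor>real k + u\<rfloor> = int k"
    using assms by (intro floor_unique) auto
  moreover have "6 * ((real k + u) / 6) = real k + u" by simp
  ultimately show ?thesis
    using assms by (simp only: approx_curve.simps Let_def) simp
next
  case False
  \<comment> \<open>At an inner breakpoint \<open>floor\<close> already selects the next map, and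
    \<open>quad_match\<close> reconciles the two values. At the parameter 1 the cap
    \<open>min 5\<close> keeps the last map.\<close>
  then have u: "u = 1" using assms by simp
  show ?thesis
  proof (cases "k < 5")
    case True
    have "6 * ((real k + 1) / 6) = real (Suc k)" by simp
    then have "approx_curve (Suc n) ((real k + u) / 6) = quad (Suc k) (approx_curve n 0)"
      using True by (simp only: u approx_curve.simps Let_def floor_of_nat nat_int) simp
    then show ?thesis
      using True by (simp add: u approx_curve_0 approx_curve_1 quad_match)
  next
    case False
    then have "k = 5" using assms by simp
    then show ?thesis by (simp add: u)
  qed
qed

lemma sixth_cases:
  fixes t :: real
  assumes "t \<in> {0..1}"
  obtains k u where "k < 6" "u \<in> {0..1}" "t = (real k + u) / 6"
proof
  define k where "k = min 5 (nat \<lfloor>6 * t\<rfloor>)"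
  show "k < 6" by (simp add: k_def)
  show "6 * t - real k \<in> {0..1}"
  proof (cases "t < 1")
    case True
    then have "\<lfloor>6 * t\<rfloor> \<le> 5" by linarith
    then have "k = nat \<lfloor>6 * t\<rfloor>" by (simp add: k_def nat_le_iff)
    then have "int k = \<lfloor>6 * t\<rfloor>" using assms by simp
    then have "real k = of_int \<lfloor>6 * t\<rfloor>" by (metis of_int_of_nat_eq)
    then show ?thesis by simp linarith
  next
    case False
    then have "t = 1" using assms by simp
    then show ?thesis by (simp add: k_def)
  qed
  show "t = (real k + (6 * t - real k)) / 6" by simp
qed

lemma approx_curve_in_unit_square: "t \<in> {0..1} \<Longrightarrow> approx_curve n t \<in> unit_square"
proof (induction n arbitrary: t)
  case (Suc n)
  obtain k u where "k < 6" "u \<in> {0..1}" "t = (real k + u) / 6"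
    using Suc.prems by (rule sixth_cases)
  then show ?case
    using Suc.IH quad_in_unit_square by (simp only: approx_curve_Suc)
qed simp

lemma dist_unit_square:
  assumes "p \<in> unit_square" "q \<in> unit_square"
  shows "dist p q \<le> 2"
proof -
  have "dist (fst p) (fst q) \<le> 1" "dist (snd p) (snd q) \<le> 1"
    using assms by (auto simp: dist_real_def mem_Times_iff)
  then show ?thesis
    using sqrt_sum_squares_le_sum[of "dist (fst p) (fst q)" "dist (snd p) (snd q)"]
    by (simp add: dist_prod_def)
qed

text \<open>Both curves enter a quarter through the same similarity, so their distance halves with
  each level; 2 is a crude bound for distances in the square.\<close>

lemma dist_approx_curve:
  "t \<in> {0..1} \<Longrightarrow> dist (approx_curve (Suc n) t) (approx_curve n t) \<le> 2 / 2 ^ n"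
proof (induction n arbitrary: t)
  case 0
  then show ?case
    using dist_unit_square[OF approx_curve_in_unit_square approx_curve_in_unit_square, of t t 1 0]
    by simp
next
  case (Suc n)
  obtain k u where ku: "k < 6" "u \<in> {0..1}" "t = (real k + u) / 6"
    using Suc.prems by (rule sixth_cases)
  show ?case
    using Suc.IH[OF ku(2)]
    by (simp only: ku(3) approx_curve_Suc[OF ku(1,2)] dist_quad) (simp add: field_simps)
qed

lemma continuous_on_approx_curve: "continuous_on {0..1} (approx_curve n)"
proof (induction n)
  case 0
  then show ?case by (auto intro!: continuous_intros)
next
  case (Suc n)
  have "continuous_on {real k / 6..(real k + 1) / 6} (approx_curve (Suc n))" if "k < 6" for k
  proof -
    have eq: "approx_curve (Suc n) t = quad k (approx_curve n (6 * t - real k))"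
      if "t \<in> {real k / 6..(real k + 1) / 6}" for t
      using approx_curve_Suc[OF \<open>k < 6\<close>, of "6 * t - real k" n] that by simp
    have "continuous_on {real k / 6..(real k + 1) / 6} (\<lambda>t. approx_curve n (6 * t - real k))"
      by (rule continuous_on_compose2[OF Suc.IH]) (auto intro!: continuous_intros)
    then have "continuous_on {real k / 6..(real k + 1) / 6}
        (\<lambda>t. quad k (approx_curve n (6 * t - real k)))"
      by (rule continuous_on_compose2[OF continuous_on_quad[of UNIV]]) auto
    then show ?thesis
      by (subst continuous_on_cong[OF refl eq]) auto
  qed
  then have "continuous_on (\<Union>k<6. {real k / 6..(real k + 1) / 6}) (approx_curve (Suc n))"
    by (intro continuous_on_closed_Union) auto
  then show ?case
  proof (rule continuous_on_subset, intro subsetI)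
    fix t :: real
    assume "t \<in> {0..1}"
    then obtain k u where "k < 6" "u \<in> {0..1}" "t = (real k + u) / 6"
      by (rule sixth_cases)
    then show "t \<in> (\<Union>k<6. {real k / 6..(real k + 1) / 6})"
      by (intro UN_I[of k]) (auto simp: divide_right_mono)
  qed
qed

section \<open>The limit curve and its image\<close>

definition curve :: "real \<Rightarrow> real \<times> real" where
  "curve t = lim (\<lambda>n. approx_curve n t)"

text \<open>Consecutive approximations differ by at most the terms of a geometric series, so the
  telescoping series converges uniformly by the Weierstrass test.\<close>

lemma uniform_limit_curve: "uniform_limit {0..1} approx_curve curve sequentially"
proof -
  define d where "d n t = approx_curve (Suc n) t - approx_curve n t" for n t
  have "uniform_limit {0..1} (\<lambda>n t. \<Sum>i<n. d i t) (\<lambda>t. \<Sum>i. d i t) sequentially"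
  proof (rule Weierstrass_m_test)
    show "norm (d n t) \<le> 2 * (1 / 2) ^ n" if "t \<in> {0..1}" for n t
      using dist_approx_curve[OF that, of n] by (simp add: d_def dist_norm power_one_over)
    show "summable (\<lambda>n. 2 * (1 / 2 :: real) ^ n)"
      by (intro summable_mult summable_geometric) simp
  qed
  then have "uniform_limit {0..1} (\<lambda>n t. approx_curve 0 t + (\<Sum>i<n. d i t))
      (\<lambda>t. approx_curve 0 t + (\<Sum>i. d i t)) sequentially"
    by (intro uniform_limit_intros)
  moreover have "approx_curve 0 t + (\<Sum>i<n. d i t) = approx_curve n t" for n t
    unfolding d_def by (subst sum_lessThan_telescope) simp
  ultimately have lim: "uniform_limit {0..1} approx_curve
      (\<lambda>t. approx_curve 0 t + (\<Sum>i. d i t)) sequentially"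
    by simp
  have "approx_curve 0 t + (\<Sum>i. d i t) = curve t" if "t \<in> {0..1}" for t
    using tendsto_uniform_limitI[OF lim that] by (simp add: curve_def limI)
  then show ?thesis
    using lim by (subst (asm) uniform_limit_cong'[OF refl]) auto
qed

lemma approx_curve_tendsto: "t \<in> {0..1} \<Longrightarrow> (\<lambda>n. approx_curve n t) \<longlonglongrightarrow> curve t"
  by (rule tendsto_uniform_limitI[OF uniform_limit_curve])

lemma continuous_on_curve: "continuous_on {0..1} curve"
  by (rule uniform_limit_theorem[OF _ uniform_limit_curve])
    (simp_all add: continuous_on_approx_curve)

text \<open>Self-similarity passes from the approximations to the limit because each
  \<open>quad k\<close> is continuous.\<close>

lemma curve_quad:
  assumes "k < 6" "u \<in> {0..1}"
  shows "curve ((real k + u) / 6) = quad k (curve u)"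
proof (rule LIMSEQ_unique)
  have "(real k + u) / 6 \<in> {0..1}" using assms by auto
  from LIMSEQ_Suc[OF approx_curve_tendsto[OF this]]
  show "(\<lambda>n. quad k (approx_curve n u)) \<longlonglongrightarrow> curve ((real k + u) / 6)"
    by (simp only: approx_curve_Suc[OF assms])
  show "(\<lambda>n. quad k (approx_curve n u)) \<longlonglongrightarrow> quad k (curve u)"
    by (rule continuous_on_tendsto_compose[OF continuous_on_quad[of UNIV]
          approx_curve_tendsto[OF assms(2)]]) auto
qed

lemma curve_image: "curve ` {0..1} = unit_square"
proof
  have "closed unit_square" by (intro closed_Times) auto
  then show "curve ` {0..1} \<subseteq> unit_square"
    using approx_curve_tendsto approx_curve_in_unit_square
    by (intro image_subsetI) (rule closed_sequentially)
next
  \<comment> \<open>Pull \<open>p\<close> back along a map whose image contains it, approximate the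
    preimage, and map forward again: the error halves. The starting approximation is the corner
    \<open>curve 0\<close>.\<close>
  have near: "\<exists>q\<in>curve ` {0..1}. dist q p \<le> 2 / 2 ^ n" if "p \<in> unit_square" for n p
    using that
  proof (induction n arbitrary: p)
    case 0
    have "curve 0 = (0, 0)"
      using approx_curve_tendsto[of 0] by (simp add: approx_curve_0 LIMSEQ_const_iff)
    then show ?case
      using dist_unit_square[OF _ 0, of "(0, 0)"] by (intro bexI[of _ "curve 0"] imageI) auto
  next
    case (Suc n)
    obtain k p' where k: "k < 6" "p' \<in> unit_square" "p = quad k p'"
      using Suc.prems by (rule quad_covers_unit_square)
    obtain u where u: "u \<in> {0..1}" "dist (curve u) p' \<le> 2 / 2 ^ n"
      using Suc.IH[OF k(2)] by auto
    have "dist (curve ((real k + u) / 6)) p \<le> 2 / 2 ^ Suc n"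
      unfolding k(3) curve_quad[OF k(1) u(1)] dist_quad using u(2) by (simp add: field_simps)
    moreover have "(real k + u) / 6 \<in> {0..1}" using k(1) u(1) by auto
    ultimately show ?case by blast
  qed
  \<comment> \<open>A compact image is closed, so arbitrarily good approximation forces
    membership.\<close>
  have "closed (curve ` {0..1})"
    by (intro compact_imp_closed compact_continuous_image continuous_on_curve) auto
  moreover have "\<exists>q\<in>curve ` {0..1}. dist q p < e" if "p \<in> unit_square" "e > 0" for p e
  proof -
    obtain n where "(1 / 2 :: real) ^ n < e / 2"
      using real_arch_pow_inv[of "e / 2" "1 / 2"] \<open>e > 0\<close> by auto
    then have "2 / 2 ^ n < e" by (simp add: power_one_over field_simps)
    then show ?thesis using near[OF that(1), of n] by (meson le_less_trans)
  qed
  ultimately show "unit_square \<subseteq> curve ` {0..1}"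
    by (metis closed_approachable subsetI)
qed

section \<open>The fractal structure\<close>

definition cell :: "nat \<Rightarrow> nat \<Rightarrow> real set" where
  "cell n j = {real j / 6 ^ n..(real j + 1) / 6 ^ n}"

text \<open>The local coordinate \<open>u\<close> puts cells into the form to which the
  self-similarity of the curve applies.\<close>

lemma cell_eq_image: "cell n j = (\<lambda>u. (real j + u) / 6 ^ n) ` {0..1}"
proof (intro equalityI subsetI)
  fix t assume "t \<in> cell n j"
  then show "t \<in> (\<lambda>u. (real j + u) / 6 ^ n) ` {0..1}"
    by (intro image_eqI[of _ _ "6 ^ n * t - real j"]) (auto simp: cell_def field_simps)
qed (auto simp: cell_def divide_right_mono)

lemma inj_cell: "inj (cell n)"
  by (rule injI) (simp add: cell_def Icc_eq_Icc divide_right_mono)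

text \<open>Appending the base 6 digit \<open>k\<close> turns \<open>j\<close> into
  \<open>6 * j + k\<close>; hence \<open>div 6\<close> recovers the parent and \<open>mod 6\<close>
  the position in it.\<close>

lemma cell_Suc_subset:
  assumes "k < 6"
  shows "cell (Suc n) (6 * j + k) \<subseteq> cell n j"
proof -
  have "real j / 6 ^ n \<le> real (6 * j + k) / 6 ^ Suc n"
    by (simp add: field_simps)
  moreover have "(real (6 * j + k) + 1) / 6 ^ Suc n \<le> (real j + 1) / 6 ^ n"
    using assms by (simp add: field_simps)
  ultimately show ?thesis by (auto simp: cell_def)
qed

lemma cell_Suc_cover:
  assumes "t \<in> cell n j"
  obtains k where "k < 6" "t \<in> cell (Suc n) (6 * j + k)"
proof -
  obtain v where v: "v \<in> {0..1}" "t = (real j + v) / 6 ^ n"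
    using assms by (auto simp: cell_eq_image)
  obtain k u where k: "k < 6" "u \<in> {0..1}" "v = (real k + u) / 6"
    using v(1) by (rule sixth_cases)
  have "t = (real (6 * j + k) + u) / 6 ^ Suc n"
    by (simp add: v(2) k(3) field_simps)
  then show ?thesis using that[OF k(1)] k(2) by (auto simp: cell_eq_image)
qed

lemma UN_cell: "(\<Union>j<6 ^ n. cell n j) = {0..1}"
proof (induction n)
  case 0
  then show ?case by (simp add: cell_def lessThan_Suc)
next
  case (Suc n)
  show ?case
  proof (intro equalityI subsetI)
    fix t :: real assume "t \<in> {0..1}"
    then obtain j where j: "j < 6 ^ n" "t \<in> cell n j" using Suc by blast
    obtain k where k: "k < 6" "t \<in> cell (Suc n) (6 * j + k)"
      using j(2) by (rule cell_Suc_cover)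
    then show "t \<in> (\<Union>j<6 ^ Suc n. cell (Suc n) j)"
      using j(1) by (intro UN_I[of "6 * j + k"]) auto
  next
    fix t assume "t \<in> (\<Union>j<6 ^ Suc n. cell (Suc n) j)"
    then obtain j where j: "j < 6 ^ Suc n" "t \<in> cell (Suc n) j" by auto
    then have "t \<in> cell n (j div 6)"
      using cell_Suc_subset[of "j mod 6" n "j div 6"] by auto
    moreover have "j div 6 < 6 ^ n" using j(1) by auto
    ultimately show "t \<in> {0..1}" using Suc by blast
  qed
qed

text \<open>Starting at level 1 provides distinct elements with the same image already for \<open>n = 0\<close>.\<close>

definition cell_structure :: "nat \<Rightarrow> (real set, real) family" where
  "cell_structure n = (cell (Suc n) ` {..<6 ^ Suc n}, \<lambda>A. A)"

lemma members_cell_structure: "members (cell_structure n) = cell (Suc n) ` {..<6 ^ Suc n}"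
  by (simp add: members_def cell_structure_def)

lemma fractal_structure_cell_structure: "fractal_structure {0..1} cell_structure"
  unfolding fractal_structure_def strongly_refines_def refines_def
proof (intro conjI allI ballI)
  fix n
  show "covering {0..1} (cell_structure n)"
    unfolding covering_def members_cell_structure by (rule UN_cell)
next
  fix n A assume "A \<in> members (cell_structure (Suc n))"
  then obtain j where j: "A = cell (Suc (Suc n)) j" "j < 6 ^ Suc (Suc n)"
    by (auto simp: members_cell_structure)
  have "A \<subseteq> cell (Suc n) (j div 6)"
    using cell_Suc_subset[of "j mod 6" "Suc n" "j div 6"] by (simp add: j(1))
  moreover have "j div 6 < 6 ^ Suc n" using j(2) by auto
  ultimately show "\<exists>B\<in>members (cell_structure n). A \<subseteq> B"
    by (auto simp: members_cell_structure)
next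
  fix n B assume "B \<in> members (cell_structure n)"
  then obtain j where j: "B = cell (Suc n) j" "j < 6 ^ Suc n"
    by (auto simp: members_cell_structure)
  show "B = \<Union> {A \<in> members (cell_structure (Suc n)). A \<subseteq> B}"
  proof (intro equalityI subsetI)
    fix t assume "t \<in> B"
    then obtain k where k: "k < 6" "t \<in> cell (Suc (Suc n)) (6 * j + k)"
      unfolding j(1) by (rule cell_Suc_cover)
    have "6 * j + k < 6 ^ Suc (Suc n)" using j(2) k(1) by auto
    then show "t \<in> \<Union> {A \<in> members (cell_structure (Suc n)). A \<subseteq> B}"
      using k cell_Suc_subset[OF k(1), of "Suc n" j] by (auto simp: members_cell_structure j(1))
  qed blast
qed

section \<open>Images of cells under the curve\<close>

lemma curve_cell_similar:
  assumes "j < 6 ^ n"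
  shows "\<exists>\<psi>. (\<forall>p q. dist (\<psi> p) (\<psi> q) = dist p q / 2 ^ n) \<and>
     (\<forall>u\<in>{0..1}. curve ((real j + u) / 6 ^ n) = \<psi> (curve u))"
  using assms
proof (induction n arbitrary: j)
  case 0
  then show ?case by (intro exI[of _ id]) auto
next
  case (Suc n)
  have "j div 6 < 6 ^ n" using Suc.prems by auto
  then obtain \<psi> where \<psi>: "\<And>p q. dist (\<psi> p) (\<psi> q) = dist p q / 2 ^ n"
    "\<And>u. u \<in> {0..1} \<Longrightarrow> curve ((real (j div 6) + u) / 6 ^ n) = \<psi> (curve u)"
    using Suc.IH by blast
  show ?case
  \<comment> \<open>The last base 6 digit of \<open>j\<close> selects the innermost map, and the
    leading digits \<open>j div 6\<close> supply the outer similarity \<open>\<psi>\<close>.\<close>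
  proof (intro exI[of _ "\<lambda>p. \<psi> (quad (j mod 6) p)"] conjI allI ballI)
    show "dist (\<psi> (quad (j mod 6) p)) (\<psi> (quad (j mod 6) q)) = dist p q / 2 ^ Suc n" for p q
      by (simp add: \<psi>(1) dist_quad)
    fix u :: real assume u: "u \<in> {0..1}"
    have k: "j mod 6 < 6" by simp
    have "real j = 6 * real (j div 6) + real (j mod 6)"
      by (metis mult_div_mod_eq of_nat_add of_nat_mult of_nat_numeral)
    then have "(real j + u) / 6 ^ Suc n = (real (j div 6) + (real (j mod 6) + u) / 6) / 6 ^ n"
      by (simp add: field_simps)
    moreover have "real (j mod 6) \<le> 5" using k by linarith
    ultimately show "curve ((real j + u) / 6 ^ Suc n) = \<psi> (quad (j mod 6) (curve u))"
      using u by (simp add: \<psi>(2) curve_quad[OF k u, symmetric])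
  qed
qed

text \<open>The image is a copy of the whole square scaled by \<open>1 / 2 ^ n\<close>: a side
  bounds the diameter from below, the crude bound 2 for the square from above.\<close>

lemma curve_cell_bounds:
  assumes "j < 6 ^ n"
  shows bounded_curve_cell: "bounded (curve ` cell n j)"
    and diameter_curve_cell_le: "diameter (curve ` cell n j) \<le> 2 / 2 ^ n"
    and diameter_curve_cell_ge: "1 / 2 ^ n \<le> diameter (curve ` cell n j)"
proof -
  obtain \<psi> where \<psi>: "\<And>p q. dist (\<psi> p) (\<psi> q) = dist p q / 2 ^ n"
    "\<And>u. u \<in> {0..1} \<Longrightarrow> curve ((real j + u) / 6 ^ n) = \<psi> (curve u)"
    using curve_cell_similar[OF assms] by blast
  have "curve ` cell n j = (\<lambda>u. \<psi> (curve u)) ` {0..1}"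
    unfolding cell_eq_image image_image using \<psi>(2) by (intro image_cong) auto
  then have im: "curve ` cell n j = \<psi> ` unit_square"
    by (simp add: image_image flip: curve_image)
  have le: "dist x y \<le> 2 / 2 ^ n" if "x \<in> \<psi> ` unit_square" "y \<in> \<psi> ` unit_square" for x y
    using that by (auto simp del: mem_Times_iff simp: \<psi>(1) intro!: divide_right_mono dist_unit_square)
  show b: "bounded (curve ` cell n j)"
    unfolding im bounded_two_points using le by blast
  show "diameter (curve ` cell n j) \<le> 2 / 2 ^ n"
    unfolding im using le by (intro diameter_le) (auto simp: dist_norm)
  have "dist (\<psi> (0, 0)) (\<psi> (1, 0)) = 1 / 2 ^ n"
    by (simp add: \<psi>(1) dist_Pair_Pair)
  moreover have "dist (\<psi> (0, 0)) (\<psi> (1, 0)) \<le> diameter (curve ` cell n j)"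
    by (rule diameter_bounded_bound[OF b]) (auto simp: im)
  ultimately show "1 / 2 ^ n \<le> diameter (curve ` cell n j)" by simp
qed

text \<open>Cells 1 and 2 are children of cell 0 one level up, so their images arise from the ranges
  of maps 1 and 2 by one common \<open>\<psi>\<close>, and those ranges agree by
  \<open>quad_1_2\<close>.\<close>

lemma curve_cell_crossed_twice: "curve ` cell (Suc n) 1 = curve ` cell (Suc n) 2"
proof -
  have "(0 :: nat) < 6 ^ n" by simp
  then obtain \<psi> where \<psi>: "\<And>u. u \<in> {0..1} \<Longrightarrow> curve ((real 0 + u) / 6 ^ n) = \<psi> (curve u)"
    using curve_cell_similar by blast
  have im: "curve ` cell (Suc n) k = (\<lambda>p. \<psi> (quad k p)) ` unit_square" if "k < 6" for k
  proof -
    have "curve ((real k + u) / 6 ^ Suc n) = \<psi> (quad k (curve u))" if u: "u \<in> {0..1}" for u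
    proof -
      have "(real k + u) / 6 \<in> {0..1}" using \<open>k < 6\<close> u by auto
      from \<psi>[OF this] show ?thesis
        by (simp add: curve_quad[OF \<open>k < 6\<close> u])
    qed
    then show ?thesis
      by (simp only: cell_eq_image image_image curve_image[symmetric] cong: image_cong)
  qed
  have refl: "(\<lambda>(x, y). (1 - x, 1 - y)) ` unit_square = unit_square"
  proof (intro equalityI subsetI)
    fix p :: "real \<times> real" assume "p \<in> unit_square"
    then show "p \<in> (\<lambda>(x, y). (1 - x, 1 - y)) ` unit_square"
      by (intro image_eqI[of _ _ "(1 - fst p, 1 - snd p)"]) auto
  qed auto
  have "(\<lambda>p. \<psi> (quad 2 p)) ` unit_square
      = (\<lambda>p. \<psi> (quad 1 p)) ` (\<lambda>(x, y). (1 - x, 1 - y)) ` unit_square"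
    unfolding image_image by (intro image_cong refl) (auto simp: quad_1_2)
  then show ?thesis by (simp add: im refl)
qed

lemma members_induced_cell_structure:
  "members (induced curve cell_structure n) = (\<lambda>j. curve ` cell (Suc n) j) ` {..<6 ^ Suc n}"
  by (simp add: members_def induced_def cell_structure_def image_image)

text \<open>This is the standing assumption under which fractal dimension III is defined.\<close>

lemma diam_vanishing_curve: "diam_vanishing (induced curve cell_structure)"
  unfolding diam_vanishing_def
proof (intro conjI allI ballI)
  show "bounded B" if "B \<in> members (induced curve cell_structure n)" for n B
    using that bounded_curve_cell by (auto simp: members_induced_cell_structure)
  have lim: "(\<lambda>n. ennreal (2 / 2 ^ Suc n)) \<longlonglongrightarrow> ennreal 0"
    by (intro tendsto_ennrealI) real_asymp
  show "(\<lambda>n. SUP B\<in>members (induced curve cell_structure n). ennreal (diameter B)) \<longlonglongrightarrow> 0"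
  proof (rule tendsto_sandwich[OF _ _ tendsto_const lim[unfolded ennreal_0]])
    show "\<forall>\<^sub>F n in sequentially. (SUP B\<in>members (induced curve cell_structure n).
        ennreal (diameter B)) \<le> ennreal (2 / 2 ^ Suc n)"
      using diameter_curve_cell_le
      by (intro always_eventually allI SUP_least)
        (auto simp: members_induced_cell_structure intro!: ennreal_leI simp del: power_Suc)
  qed simp
qed

section \<open>Comparison of the dimensions\<close>

lemma pow_sum_ge_1:
  fixes s :: real
  assumes "0 \<le> s" "s \<le> 5 / 2"
  shows "1 \<le> 6 ^ l * (1 / 2 ^ l) powr s"
proof -
  \<comment> \<open>The product equals \<open>(6 / 2 powr s) ^ l\<close>, so
    \<open>2 powr s \<le> 6\<close> suffices. At the exponent 5/2 this reads sqrt 32 <= sqrt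
    36.\<close>
  have "(2 :: real) powr (5 / 2) = (2 powr 5) powr (1 / 2)"
    by (simp only: powr_powr) simp
  also have "\<dots> = sqrt (2 powr 5)"
    by (rule powr_half_sqrt) simp
  also have "\<dots> \<le> sqrt (6\<^sup>2)"
    by (rule real_sqrt_le_mono) simp
  finally have "(2 :: real) powr (5 / 2) \<le> 6" by simp
  moreover have "(2 :: real) powr s \<le> 2 powr (5 / 2)"
    by (rule powr_mono[OF assms(2)]) simp
  ultimately have "(2 :: real) powr s \<le> 6" by linarith
  then have le: "(2 powr s) ^ l \<le> (6 :: real) ^ l"
    by (intro power_mono) auto
  have "(1 / 2 ^ l :: real) powr s = 1 / (2 powr s) ^ l"
    by (simp add: powr_divide powr_power powr_realpow[symmetric] powr_powr mult.commute)
  then show ?thesis using le by (simp only: mult_1_right times_divide_eq_right) simp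
qed

text \<open>Below the exponent 5/2 the sum at every level is at least 1, so \<open>H3\<close> cannot
  vanish. The number 5/2 is a convenient value between 2 and ln 6 / ln 2.\<close>

lemma curve_dim_ge: "ereal (5 / 2) \<le> curve_dim cell_structure curve"
  unfolding curve_dim_def fractal_dim3_def
proof (rule Inf_greatest, clarify)
  let ?\<Delta> = "induced curve cell_structure" and ?F = "curve ` {0..1}"
  fix s :: real
  assume s: "0 \<le> s" "H3 ?\<Delta> ?F s = 0"
  show "ereal (5 / 2) \<le> ereal s"
  proof (rule ccontr)
    assume "\<not> ereal (5 / 2) \<le> ereal s"
    then have s': "s \<le> 5 / 2" by simp
    have "1 \<le> (\<Sum>\<^sub>\<infinity>i\<in>{i \<in> fst (?\<Delta> l). snd (?\<Delta> l) i \<inter> ?F \<noteq> {}}. diam_pow s (snd (?\<Delta> l) i))"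
      for l
    proof -
      let ?I = "cell (Suc l) ` {..<6 ^ Suc l}"
      have sub: "cell (Suc l) j \<subseteq> {0..1}" if "j < 6 ^ Suc l" for j
        using UN_cell[of "Suc l"] that by blast
      have ne: "cell (Suc l) j \<noteq> {}" for j
        by (auto simp: cell_def divide_right_mono)
      have "{i \<in> fst (?\<Delta> l). snd (?\<Delta> l) i \<inter> ?F \<noteq> {}} = ?I"
        using sub ne by (force simp: induced_def cell_structure_def)
      then have "(\<Sum>\<^sub>\<infinity>i\<in>{i \<in> fst (?\<Delta> l). snd (?\<Delta> l) i \<inter> ?F \<noteq> {}}. diam_pow s (snd (?\<Delta> l) i))
          = (\<Sum>i\<in>?I. diam_pow s (curve ` i))"
        by (simp add: infsum_finite induced_def cell_structure_def)
      \<comment> \<open>Indices are the cells themselves, which are distinct; coinciding images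
        therefore stay counted with multiplicity, giving powers of 6 instead of 4.\<close>
      also have "\<dots> = (\<Sum>j<6 ^ Suc l. diam_pow s (curve ` cell (Suc l) j))"
        by (rule sum.reindex[OF inj_on_subset[OF inj_cell], unfolded o_def]) simp
      also have "\<dots> \<ge> (\<Sum>j<(6 ^ Suc l :: nat). ennreal ((1 / 2 ^ Suc l) powr s))"
      proof (rule sum_mono)
        fix j :: nat assume "j \<in> {..<6 ^ Suc l}"
        then have "1 / 2 ^ Suc l \<le> diameter (curve ` cell (Suc l) j)"
          by (intro diameter_curve_cell_ge) simp
        then have "(1 / 2 ^ Suc l) powr s \<le> diameter (curve ` cell (Suc l) j) powr s"
          using s(1) by (intro powr_mono2) auto
        \<comment> \<open>For \<open>s = 0\<close> both sides are 1, by the convention in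
          \<open>diam_pow\<close> for nonempty sets.\<close>
        then show "ennreal ((1 / 2 ^ Suc l) powr s) \<le> diam_pow s (curve ` cell (Suc l) j)"
          using ne by (auto simp: diam_pow_def intro: ennreal_leI)
      qed
      also have "(\<Sum>j<(6 ^ Suc l :: nat). ennreal ((1 / 2 ^ Suc l) powr s))
          = ennreal (6 ^ Suc l * (1 / 2 ^ Suc l) powr s)"
        by (subst sum_ennreal) (simp_all del: power_Suc)
      finally have "ennreal (6 ^ Suc l * (1 / 2 ^ Suc l) powr s)
        \<le> (\<Sum>\<^sub>\<infinity>i\<in>{i \<in> fst (?\<Delta> l). snd (?\<Delta> l) i \<inter> ?F \<noteq> {}}. diam_pow s (snd (?\<Delta> l) i))" .
      moreover have "1 \<le> ennreal (6 ^ Suc l * (1 / 2 ^ Suc l) powr s)"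
        using pow_sum_ge_1[OF s(1) s', of "Suc l"] by (metis ennreal_1 ennreal_leI)
      ultimately show ?thesis by (rule order_trans[rotated])
    qed
    then have "1 \<le> H3n ?\<Delta> ?F s 0"
      unfolding H3n_def by (intro INF_greatest)
    also have "\<dots> \<le> (SUP n. H3n ?\<Delta> ?F s n)"
      by (rule SUP_upper) simp
    \<comment> \<open>Raising \<open>n\<close> leaves fewer levels in the infimum, so the sequence
      increases and its limit exists as the supremum.\<close>
    also have "\<dots> = H3 ?\<Delta> ?F s"
    proof -
      have "incseq (H3n ?\<Delta> ?F s)"
        unfolding H3n_def by (intro incseq_SucI INF_superset_mono) auto
      then show ?thesis unfolding H3_def by (intro limI[symmetric] LIMSEQ_SUP)
    qed
    finally show False using s(2) by simp
  qed
qed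

section \<open>Box dimension of the square\<close>

lemma box_count_unit_square:
  assumes "\<delta> > 0"
  shows "box_count unit_square \<delta> = (nat (\<lfloor>1 / \<delta>\<rfloor> + 2))\<^sup>2"
proof -
  \<comment> \<open>The grid intervals are closed, so index -1 counts through the single point 0.
    With indices running up to the floor, this explains the summand 2.\<close>
  have meets: "{of_int a * \<delta>..(of_int a + 1) * \<delta>} \<inter> {0..1} \<noteq> {} \<longleftrightarrow> a \<in> {-1..\<lfloor>1 / \<delta>\<rfloor>}"
    for a :: int
  proof -
    have "{of_int a * \<delta>..(of_int a + 1) * \<delta>} \<inter> {0..1} \<noteq> {} \<longleftrightarrow>
        0 \<le> (of_int a + 1) * \<delta> \<and> of_int a * \<delta> \<le> 1"
      using assms by (auto simp: Int_atLeastAtMost mult_right_mono)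
    also have "0 \<le> (of_int a + 1) * \<delta> \<longleftrightarrow> -1 \<le> a"
      using assms by (simp add: zero_le_mult_iff) linarith
    also have "of_int a * \<delta> \<le> 1 \<longleftrightarrow> a \<le> \<lfloor>1 / \<delta>\<rfloor>"
      using assms by (simp add: le_floor_iff field_simps)
    finally show ?thesis by simp
  qed
  have "grid_square \<delta> k \<inter> unit_square \<noteq> {} \<longleftrightarrow> k \<in> {-1..\<lfloor>1 / \<delta>\<rfloor>} \<times> {-1..\<lfloor>1 / \<delta>\<rfloor>}" for k
    unfolding grid_square_def Times_Int_Times Times_empty mem_Times_iff de_Morgan_disj
    by (simp only: meets)
  then show ?thesis
    by (simp add: box_count_def card_cartesian_product power2_eq_square add.commute)
qed

lemma has_box_dim_unit_square: "has_box_dim unit_square 2"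
proof -
  have small: "\<forall>\<^sub>F \<delta> in at_right 0. \<delta> \<in> {0<..<1 :: real}"
    by (rule eventually_at_right_real) simp
  have count: "1 / \<delta> \<le> real (nat (\<lfloor>1 / \<delta>\<rfloor> + 2)) \<and> real (nat (\<lfloor>1 / \<delta>\<rfloor> + 2)) \<le> 1 / \<delta> + 2"
    if "\<delta> > 0" for \<delta> :: real
  proof -
    have "0 \<le> \<lfloor>1 / \<delta>\<rfloor>" using that by simp
    then have "real (nat (\<lfloor>1 / \<delta>\<rfloor> + 2)) = of_int \<lfloor>1 / \<delta>\<rfloor> + 2" by simp
    then show ?thesis by linarith
  qed
  \<comment> \<open>Squeeze the count between the squares of \<open>1 / \<delta>\<close> and
    \<open>1 / \<delta> + 2\<close>; for \<open>\<delta>\<close> below 1 the denominator is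
    positive.\<close>
  have "((\<lambda>\<delta>. ln (real (box_count unit_square \<delta>)) / (- ln \<delta>)) \<longlongrightarrow> 2) (at_right 0)"
  proof (rule tendsto_sandwich)
    show "\<forall>\<^sub>F \<delta> in at_right 0. ln ((1 / \<delta>)\<^sup>2) / (- ln \<delta>)
        \<le> ln (real (box_count unit_square \<delta>)) / (- ln \<delta>)"
      using small
    proof eventually_elim
      case (elim \<delta>)
      then have "(1 / \<delta>)\<^sup>2 \<le> real (box_count unit_square \<delta>)"
        using count[of \<delta>] by (simp add: box_count_unit_square power_mono del: power_divide)
      then show ?case using elim by (intro divide_right_mono) (auto intro!: ln_mono)
    qed
    show "\<forall>\<^sub>F \<delta> in at_right 0. ln (real (box_count unit_square \<delta>)) / (- ln \<delta>)
        \<le> ln ((1 / \<delta> + 2)\<^sup>2) / (- ln \<delta>)"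
      using small
    proof eventually_elim
      case (elim \<delta>)
      then have "real (box_count unit_square \<delta>) \<le> (1 / \<delta> + 2)\<^sup>2"
        using count[of \<delta>] by (simp add: box_count_unit_square power_mono)
      moreover have "0 < real (box_count unit_square \<delta>)"
      proof -
        have "0 < 1 / \<delta>" using elim by simp
        then have "0 < real (nat (\<lfloor>1 / \<delta>\<rfloor> + 2))"
          using count[of \<delta>] elim by (simp only: greaterThanLessThan_iff) linarith
        then show ?thesis using elim by (simp add: box_count_unit_square)
      qed
      ultimately show ?case using elim by (intro divide_right_mono) (auto intro!: ln_mono)
    qed
    show "((\<lambda>\<delta>. ln ((1 / \<delta>)\<^sup>2) / (- ln \<delta>)) \<longlongrightarrow> 2) (at_right (0 :: real))"
      by real_asymp
    show "((\<lambda>\<delta>. ln ((1 / \<delta> + 2)\<^sup>2) / (- ln \<delta>)) \<longlongrightarrow> 2) (at_right (0 :: real))"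
      by real_asymp
  qed
  from tendsto_ereal[OF this] show ?thesis
    by (simp add: has_box_dim_def)
qed

section \<open>Upper bound for the Hausdorff dimension of the square\<close>

lemma hausdorff_pre_unit_square_le:
  assumes "n > 0" "2 / real n \<le> \<delta>" "0 < s"
  shows "hausdorff_pre s \<delta> unit_square \<le> ennreal ((real n)\<^sup>2 * (2 / real n) powr s)"
proof -
  define I where "I a = {real a / real n..(real a + 1) / real n}" for a
  \<comment> \<open>\<open>div\<close> and \<open>mod\<close> list the \<open>n * n\<close> grid
    squares as a sequence, padded with empty sets, which contribute 0 to the sum.\<close>
  define U where "U i = (if i < n\<^sup>2 then I (i div n) \<times> I (i mod n) else {})" for i
  have cover: "\<exists>a<n. x \<in> I a" if "x \<in> {0..1}" for x
  proof (cases "x < 1")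
    case True
    have x0: "0 \<le> real n * x" using that by simp
    have "real (nat \<lfloor>real n * x\<rfloor>) \<le> real n * x" "real n * x \<le> real (nat \<lfloor>real n * x\<rfloor>) + 1"
      using x0 by linarith+
    moreover have "real n * x < real n" using True assms(1) by simp
    moreover from calculation have "nat \<lfloor>real n * x\<rfloor> < n"
      by (metis le_less_trans of_nat_less_iff)
    ultimately show ?thesis using assms(1)
      by (intro exI[of _ "nat \<lfloor>real n * x\<rfloor>"]) (auto simp: I_def field_simps)
  next
    case False
    \<comment> \<open>Here the floor would give the index \<open>n\<close>, so the right endpoint is
      assigned to the last interval.\<close>
    then have "x = 1" using that by simp
    then show ?thesis using assms(1)
      by (intro exI[of _ "n - 1"]) (auto simp: I_def field_simps of_nat_diff)
  qed
  have "unit_square \<subseteq> (\<Union>i. U i)"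
  proof
    fix p assume "p \<in> unit_square"
    then obtain a b where ab: "a < n" "b < n" "fst p \<in> I a" "snd p \<in> I b"
      using cover by (metis mem_Times_iff)
    have "a * n + b < (a + 1) * n" using ab(2) by simp
    also have "\<dots> \<le> n * n" using ab(1) by (intro mult_right_mono) auto
    finally have "p \<in> U (a * n + b)"
      using ab assms(1) by (simp add: U_def power2_eq_square mem_Times_iff)
    then show "p \<in> (\<Union>i. U i)" by blast
  qed
  moreover have dist_U: "dist p q \<le> 2 / real n" if "p \<in> U i" "q \<in> U i" for p q i
  proof -
    have d: "dist x y \<le> 1 / real n" if "x \<in> I a" "y \<in> I a" for x y a
      using that by (auto simp: I_def dist_real_def abs_if add_divide_distrib)
    have "dist (fst p) (fst q) \<le> 1 / real n" "dist (snd p) (snd q) \<le> 1 / real n"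
      using that by (auto simp: U_def mem_Times_iff intro!: d split: if_splits)
    then show ?thesis
      using sqrt_sum_squares_le_sum[of "dist (fst p) (fst q)" "dist (snd p) (snd q)"]
      by (simp add: dist_prod_def)
  qed
  then have bounded_U: "bounded (U i)" for i
    unfolding bounded_two_points by blast
  have diam_U: "diameter (U i) \<le> 2 / real n" for i
    using dist_U by (intro diameter_le) (auto simp: dist_norm)
  ultimately have "hausdorff_pre s \<delta> unit_square \<le> (\<Sum>i. diam_pow s (U i))"
    unfolding hausdorff_pre_def using bounded_U diam_U assms(2)
    by (intro INF_lower) (auto intro: order_trans)
  also have "\<dots> = (\<Sum>i<n\<^sup>2. diam_pow s (U i))"
    by (rule suminf_finite) (auto simp: U_def diam_pow_def)
  also have "\<dots> \<le> (\<Sum>i<n\<^sup>2. ennreal ((2 / real n) powr s))"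
    using diam_U bounded_U assms(3)
    by (intro sum_mono) (auto simp: diam_pow_def intro!: ennreal_leI powr_mono2 diameter_ge_0)
  also have "\<dots> = ennreal ((real n)\<^sup>2 * (2 / real n) powr s)"
    by (subst sum_ennreal) simp_all
  finally show ?thesis .
qed

text \<open>At exponent 9/4 the cost of the grid cover decays like n to the power -1/4. The value
  9/4 lies between 2 and 5/2, so this upper bound already separates the dimensions.\<close>

lemma hausdorff_dim_unit_square_le: "hausdorff_dim unit_square \<le> ereal (9 / 4)"
proof -
  have "hausdorff_pre (9 / 4) \<delta> unit_square = 0" if "\<delta> > 0" for \<delta>
  proof -
    have "(\<lambda>n. ennreal ((real n)\<^sup>2 * (2 / real n) powr (9 / 4))) \<longlonglongrightarrow> ennreal 0"
      by (intro tendsto_ennrealI) real_asymp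
    moreover have "\<forall>\<^sub>F n in sequentially. hausdorff_pre (9 / 4) \<delta> unit_square
        \<le> ennreal ((real n)\<^sup>2 * (2 / real n) powr (9 / 4))"
    proof -
      have "(\<lambda>n. 2 / real n) \<longlonglongrightarrow> 0" by real_asymp
      from order_tendstoD(2)[OF this that] eventually_gt_at_top[of 0]
      show ?thesis
        by eventually_elim (intro hausdorff_pre_unit_square_le, auto)
    qed
    ultimately have "hausdorff_pre (9 / 4) \<delta> unit_square \<le> ennreal 0"
      by (rule tendsto_lowerbound) simp
    then show ?thesis by simp
  qed
  then have "hausdorff_measure (9 / 4) unit_square = 0"
    unfolding hausdorff_measure_def by (intro antisym SUP_least) auto
  then show ?thesis
    unfolding hausdorff_dim_def by (intro Inf_lower CollectI exI[of _ "9 / 4"]) auto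
qed

theorem mainTheorem8:
  shows "\<exists>(\<Gamma> :: nat \<Rightarrow> (real set, real) family) (\<beta> :: real \<Rightarrow> real \<times> real).
    fractal_structure {0..1} \<Gamma> \<and>
    continuous_on {0..1} \<beta> \<and>
    \<beta> ` {0..1} = {0..1} \<times> {0..1} \<and>
    (\<forall>n. \<exists>A\<in>members (\<Gamma> n). \<exists>A'\<in>members (\<Gamma> n). A \<noteq> A' \<and> \<beta> ` A = \<beta> ` A') \<and>
    diam_vanishing (induced \<beta> \<Gamma>) \<and>
    (\<exists>d. has_box_dim (\<beta> ` {0..1}) d \<and> curve_dim \<Gamma> \<beta> \<noteq> d) \<and>
    curve_dim \<Gamma> \<beta> \<noteq> hausdorff_dim (\<beta> ` {0..1})"
proof (intro exI[of _ cell_structure] exI[of _ curve] conjI allI)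
  show "\<exists>A\<in>members (cell_structure n). \<exists>A'\<in>members (cell_structure n).
      A \<noteq> A' \<and> curve ` A = curve ` A'" for n
  proof (intro bexI conjI)
    show "cell (Suc n) 1 \<noteq> cell (Suc n) 2" by (simp add: inj_eq[OF inj_cell])
    have "(6 :: nat) \<le> 6 ^ Suc n" by simp
    then have "1 < (6 :: nat) ^ Suc n" "2 < (6 :: nat) ^ Suc n" by linarith+
    then show "cell (Suc n) 1 \<in> members (cell_structure n)"
      "cell (Suc n) 2 \<in> members (cell_structure n)"
      unfolding members_cell_structure by blast+
  qed (rule curve_cell_crossed_twice)
  have "(2 :: ereal) < ereal (5 / 2)" by simp
  then show "\<exists>d. has_box_dim (curve ` {0..1}) d \<and> curve_dim cell_structure curve \<noteq> d"
    using has_box_dim_unit_square curve_dim_ge by (auto simp: curve_image)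
  have "ereal (9 / 4) < ereal (5 / 2)" by simp
  then have "hausdorff_dim unit_square < curve_dim cell_structure curve"
    using curve_dim_ge hausdorff_dim_unit_square_le by (meson le_less_trans less_le_trans)
  then show "curve_dim cell_structure curve \<noteq> hausdorff_dim (curve ` {0..1})"
    by (simp add: curve_image)
qed (rule fractal_structure_cell_structure continuous_on_curve curve_image diam_vanishing_curve)+

end
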